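(* Let $k\ge 2$, $n\ge 2$, and $2\le m\le|\mathbf{Neck}_k(n)|$. Let $\alpha_1,\alpha_2,\ldots,\alpha_m$ be the first $m$ strings of $\mathbf{Neck}_k(n)$ when it is listed in colexicographic order. Then $\text{UC}(\alpha_1,\ldots,\alpha_m)=pr(\alpha_1)pr(\alpha_2)\cdots pr(\alpha_m)$ is a universal cycle for $\mathbf{S}=\bigcup_{i=1}^m\mathbf{sub}_n(\alpha_i)$.
   Context: $\Sigma_k=\{0,1,\ldots,k-1\}$ with the natural order; $\Sigma_k^n$ is the set of strings of length $n$ over $\Sigma_k$. A necklace is a string that is lexicographically smallest among all its rotations; $\mathbf{Neck}_k(n)$ is the set of $k$-ary necklaces of length $n$. Colexicographic order on strings of equal length: $a_1\cdots a_n$ precedes $b_1\cdots b_n$ if $a_i<b_i$ at the largest $i$ with $a_i\ne b_i$. The periodic reduction $pr(a_1\cdots a_n)$ is $a_1\cdots a_p$ where $p$ is the smallest integer with $a_1\cdots a_n=(a_1\cdots a_p)^{n/p}$. For a string $\alpha$, $\mathbf{sub}_n(\alpha)$ is the set of all length-$n$ substrings of $\alpha$ viewed as a cyclic string (windows may wrap around). For a nonempty $\mathbf{S}\subseteq\Sigma_k^n$, a universal cycle for $\mathbf{S}$ is a string of length $|\mathbf{S}|$ which, viewed cyclically, contains every string of $\mathbf{S}$ as a length-$n$ substring exactly once. *)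

theory Defs
  imports Main "HOL-Library.List_Lexorder"
begin

text \<open>Letters are natural numbers; position \<open>i\<close> of a string is its \<open>i + 1\<close>-st letter.\<close>

definition strings :: "nat \<Rightarrow> nat \<Rightarrow> nat list set" where
  "strings k n = {w. length w = n \<and> set w \<subseteq> {..<k}}"

definition necklace :: "nat list \<Rightarrow> bool" where
  "necklace w \<longleftrightarrow> (\<forall>i. w \<le> rotate i w)"

definition Neck :: "nat \<Rightarrow> nat \<Rightarrow> nat list set" where
  "Neck k n = {w \<in> strings k n. necklace w}"

definition colex_less :: "nat list \<Rightarrow> nat list \<Rightarrow> bool" where
  "colex_less a b \<longleftrightarrow> length a = length b \<and>
     (\<exists>i<length a. a ! i < b ! i \<and> (\<forall>j. i < j \<and> j < length a \<longrightarrow> a ! j = b ! j))"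

definition pr :: "nat list \<Rightarrow> nat list" where
  "pr w = take (LEAST p. 0 < p \<and> p dvd length w \<and>
                  w = concat (replicate (length w div p) (take p w))) w"

definition cyclic_window :: "nat \<Rightarrow> nat list \<Rightarrow> nat \<Rightarrow> nat list" where
  "cyclic_window n w i = map (\<lambda>j. w ! ((i + j) mod length w)) [0..<n]"

definition sub :: "nat \<Rightarrow> nat list \<Rightarrow> nat list set" where
  "sub n w = cyclic_window n w ` {..<length w}"

text \<open>``Exactly once'' counts starting positions modulo the length of the cycle.\<close>

definition universal_cycle :: "nat \<Rightarrow> nat \<Rightarrow> nat list set \<Rightarrow> nat list \<Rightarrow> bool" where
  "universal_cycle k n S u \<longleftrightarrow>
     S \<noteq> {} \<and> S \<subseteq> strings k n \<and>
     set u \<subseteq> {..<k} \<and> length u = card S \<and>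
     (\<forall>s\<in>S. \<exists>!i. i < length u \<and> cyclic_window n u i = s)"

definition UC :: "nat list list \<Rightarrow> nat list" where
  "UC as = concat (map pr as)"

end

theory Submission
  imports Defs "HOL-Library.Sublist" "HOL-Combinatorics.Cycles" "HOL-Combinatorics.Orbits"
begin

text \<open>
  Write a necklace other than \<open>0\<^sup>n\<close> as \<open>\<alpha> = 0\<^sup>j x \<beta>\<close> with \<open>x > 0\<close>. Replacing \<open>x\<close> by \<open>0\<close> gives
  another necklace, which precedes \<open>\<alpha>\<close> in colexicographic order and also ends in \<open>\<beta>\<close>; hence the
  immediate predecessor of \<open>\<alpha>\<close> ends in \<open>\<beta>\<close> too. By induction the cycle \<open>U\<close> built so far ends in
  that predecessor, so it ends in \<open>\<beta>\<close>, and it begins with \<open>0\<^sup>n\<close>. Since \<open>\<beta>\<close> and \<open>0\<^sup>j\<close>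
  together have length \<open>n - 1\<close>, appending \<open>pr \<alpha>\<close> joins the cycles of \<open>U\<close> and \<open>pr \<alpha>\<close> at a common
  factor of length \<open>n - 1\<close>, so no window is lost and all rotations of \<open>\<alpha>\<close> appear. As \<open>\<alpha>\<close> has
  exactly \<open>length (pr \<alpha>)\<close> distinct rotations, counting shows that each window occurs once.
\<close>

subsection \<open>Lexicographic order\<close>

lemma append_less_append_iff:
  fixes xs ys zs :: "'a::order list"
  shows "xs @ ys < xs @ zs \<longleftrightarrow> ys < zs"
  by (simp add: list_less_def lexord_same_pref_iff)

lemma take_mono_le:
  fixes xs ys :: "'a::linorder list"
  assumes "xs \<le> ys"
  shows "take i xs \<le> take i ys"
  using assms
proof (induction i arbitrary: xs ys)
  case 0
  then show ?case by simp
next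
  case (Suc i)
  then show ?case by (cases xs; cases ys) auto
qed

lemma less_if_take_less:
  fixes xs ys :: "'a::linorder list"
  assumes "take i xs < take i ys"
  shows "xs < ys"
  using take_mono_le[of ys xs i] assms by (meson leD leI)

lemma prefix_if_lex_between:
  fixes ps xs ys zs :: "'a::order list"
  assumes "ps @ xs \<le> ys" and "ys \<le> ps @ zs"
  shows "prefix ps ys"
  using assms
proof (induction ps arbitrary: ys)
  case Nil
  then show ?case by simp
next
  case (Cons p ps)
  then show ?case by (cases ys) auto
qed

lemma replicate_append_le_append_replicate:
  fixes z :: "'a::linorder"
  assumes "\<And>x. x \<in> set xs \<Longrightarrow> z \<le> x"
  shows "replicate i z @ xs \<le> xs @ replicate i z"
  using assms
proof (induction xs)
  case Nil
  then show ?case by simp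
next
  case (Cons x xs)
  show ?case
  proof (cases "x = z")
    case True
    have "replicate i z @ xs \<le> xs @ replicate i z"
      using Cons by simp
    then show ?thesis
      by (simp add: True replicate_app_Cons_same)
  next
    case False
    then have "z < x" using Cons.prems by (simp add: order_less_le)
    then show ?thesis by (cases i) auto
  qed
qed

lemma replicate_length_le:
  fixes z :: "'a::linorder"
  assumes "\<And>x. x \<in> set xs \<Longrightarrow> z \<le> x"
  shows "replicate (length xs) z \<le> xs"
  using assms by (induction xs) (auto simp: order_less_le)

lemma colex_less_imp_rev_less:
  assumes "colex_less a b"
  shows "rev a < rev b"
proof -
  obtain i where i: "i < length a" "length a = length b" "a ! i < b ! i"
    and above: "\<And>j. i < j \<Longrightarrow> j < length a \<Longrightarrow> a ! j = b ! j"
    using assms by (auto simp: colex_less_def)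
  have drop_eq: "drop (Suc i) a = drop (Suc i) b"
    using i(2) above by (intro nth_equalityI) auto
  obtain v w s x y where "a = v @ x # s" "b = w @ y # s" "x < y"
  proof
    show "a = take i a @ a ! i # drop (Suc i) a"
      by (rule id_take_nth_drop[OF i(1)])
    show "b = take i b @ b ! i # drop (Suc i) a"
      unfolding drop_eq using i(1,2) by (intro id_take_nth_drop) simp
  qed (rule i(3))
  then show ?thesis by (simp add: append_less_append_iff)
qed

subsection \<open>Periodic reductions and rotations\<close>

lemma eq_concat_replicate_iff_append_commute:
  assumes "length w = r * length g"
  shows "w = concat (replicate r g) \<longleftrightarrow> g @ w = w @ g"
  using assms
proof (induction r arbitrary: w)
  case 0
  then show ?case by simp
next
  case (Suc r)
  have length_le: "length g \<le> length w" using Suc.prems by simp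
  show ?case
  proof (cases "prefix g w")
    case True
    then obtain v where w: "w = g @ v" by (elim prefixE)
    then have "v = concat (replicate r g) \<longleftrightarrow> g @ v = v @ g"
      using Suc by simp
    then show ?thesis by (simp add: w)
  next
    case False
    have "w \<noteq> concat (replicate (Suc r) g)"
      using False by (metis concat.simps(2) prefixI replicate_Suc)
    moreover have "g @ w \<noteq> w @ g"
      using False length_le prefix_length_prefix[of g "g @ w" w] by (metis prefixI)
    ultimately show ?thesis by simp
  qed
qed

lemma rotate_eq_iff_append_commute:
  assumes "prefix g w"
  shows "rotate (length g) w = w \<longleftrightarrow> g @ w = w @ g"
proof -
  obtain v where w: "w = g @ v" using assms by (elim prefixE)
  have "rotate (length g) w = w \<longleftrightarrow> v @ g = g @ v"
    by (simp add: w rotate_append)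
  also have "\<dots> \<longleftrightarrow> g @ w = w @ g"
    by (simp add: w eq_commute[of "v @ g"])
  finally show ?thesis .
qed

lemma eq_concat_replicate_take_iff_rotate:
  assumes "p dvd length w"
  shows "w = concat (replicate (length w div p) (take p w)) \<longleftrightarrow> rotate p w = w"
proof (cases "w = []")
  case False
  then have "length (take p w) = p"
    using assms by (simp add: dvd_imp_le)
  then show ?thesis
    using assms eq_concat_replicate_iff_append_commute[of w "length w div p" "take p w"]
      rotate_eq_iff_append_commute[of "take p w" w]
    by (simp add: take_is_prefix)
qed simp

lemma rotate1_funpow_length: "(rotate1 ^^ length w) w = w"
  by (simp flip: rotate_def)

lemma length_pr:
  assumes "w \<noteq> []"
  shows "length (pr w) = least_power rotate1 w"
proof -
  let ?l = "least_power rotate1 w"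
  have dvd: "?l dvd length w"
    by (rule least_power_minimal[OF rotate1_funpow_length])
  moreover have "rotate ?l w = w" "0 < ?l"
    using least_powerI[OF rotate1_funpow_length] assms by (simp_all add: rotate_def)
  moreover have "?l \<le> p" if "0 < p" "rotate p w = w" for p
    using least_power_le[of p rotate1 w] that by (simp add: rotate_def)
  ultimately have "(LEAST p. 0 < p \<and> p dvd length w
      \<and> w = concat (replicate (length w div p) (take p w))) = ?l"
    using eq_concat_replicate_take_iff_rotate[of _ w] by (intro Least_equality) auto
  then show ?thesis
    using dvd assms by (simp add: pr_def dvd_imp_le)
qed

lemma prefix_pr: "prefix (pr w) w"
  by (simp add: pr_def take_is_prefix)

lemma rotate_length_pr: "rotate (length (pr w)) w = w"
proof (cases "w = []")
  case False
  then show ?thesis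
    using least_powerI(1)[OF rotate1_funpow_length, of w] by (simp add: length_pr rotate_def)
qed simp

lemma pr_append_commute: "pr w @ w = w @ pr w"
  using rotate_eq_iff_append_commute[OF prefix_pr] rotate_length_pr by blast

lemma set_pr: "set (pr w) = set w"
proof (cases "w = []")
  case True
  then show ?thesis by (simp add: pr_def)
next
  case False
  have "length (pr w) dvd length w"
    using least_power_minimal[OF rotate1_funpow_length] by (simp add: length_pr False)
  moreover have "take (length (pr w)) w = pr w"
    using prefix_pr by (metis append_eq_conv_conj prefixE)
  ultimately have "w = concat (replicate (length w div length (pr w)) (pr w))"
    using eq_concat_replicate_take_iff_rotate[of "length (pr w)" w] rotate_length_pr by simp
  then have "set w = set (concat (replicate (length w div length (pr w)) (pr w)))"
    by (rule arg_cong)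
  also have "\<dots> \<subseteq> set (pr w)" by auto
  finally show ?thesis
    using set_mono_prefix[OF prefix_pr] by blast
qed

lemma card_orbit_eq_least_power:
  assumes "x \<in> orbit f x"
  shows "card (orbit f x) = least_power f x"
proof -
  have "card (orbit f x) = funpow_dist1 f x x"
    unfolding orbit_conv_funpow_dist1[OF assms]
    using card_image[OF inj_on_funpow_dist1[OF assms]] by simp
  also have "\<dots> = least_power f x"
  proof (rule antisym)
    have fixed: "(f ^^ funpow_dist1 f x x) x = x"
      by (rule funpow_dist1_prop[OF assms])
    show "least_power f x \<le> funpow_dist1 f x x"
      by (rule least_power_le[OF fixed]) simp
    show "funpow_dist1 f x x \<le> least_power f x"
      using least_powerI[OF fixed] assms by (intro funpow_dist1_le_self) simp_all
  qed
  finally show ?thesis .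
qed

lemma sub_eq_orbit:
  assumes "w \<noteq> []"
  shows "sub (length w) w = orbit rotate1 w"
proof -
  have "cyclic_window (length w) w i = (rotate1 ^^ i) w" for i
    unfolding rotate_def[symmetric]
    by (intro nth_equalityI) (auto simp: cyclic_window_def nth_rotate)
  then show ?thesis
    using orbit_altdef_bounded[OF rotate1_funpow_length] assms by (auto simp: sub_def)
qed

lemma self_in_orbit_rotate1:
  assumes "w \<noteq> []"
  shows "w \<in> orbit rotate1 w"
  using rotate1_funpow_length[of w] assms
  by (metis (mono_tags) CollectI length_greater_0_conv orbit_altdef)

lemma card_sub:
  assumes "w \<noteq> []"
  shows "card (sub (length w) w) = length (pr w)"
  using assms by (simp add: sub_eq_orbit card_orbit_eq_least_power self_in_orbit_rotate1 length_pr)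

lemma sub_eq_rotate_less_length_pr:
  assumes "w \<noteq> []"
  shows "sub (length w) w = {rotate i w | i. i < length (pr w)}"
  using orbit_altdef_bounded[of "length (pr w)" rotate1 w] rotate_length_pr[of w] assms
  by (auto simp: sub_eq_orbit rotate_def set_pr simp flip: set_empty)

subsection \<open>Joining cycles at a common factor\<close>

lemma sublist_append_appendD:
  assumes "sublist s (xs @ ys @ zs)" and "length s \<le> Suc (length ys)"
  shows "sublist s (xs @ ys) \<or> sublist s (ys @ zs)"
proof -
  obtain ps qs where s: "xs @ ys @ zs = ps @ s @ qs"
    using assms(1) by (auto simp: sublist_def)
  show ?thesis
  proof (cases "length xs \<le> length ps")
    case True
    then have "ys @ zs = drop (length xs) ps @ s @ qs"
      using arg_cong[OF s, of "drop (length xs)"] by simp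
    then show ?thesis by simp
  next
    case False
    have "xs @ ys = take (length (xs @ ys)) (ps @ s @ qs)"
      by (simp flip: s)
    also have "\<dots> = ps @ s @ take (length (xs @ ys) - length (ps @ s)) qs"
      using False assms(2) by simp
    finally show ?thesis by (metis sublist_appendI)
  qed
qed

text \<open>The cycles of \<open>u\<close> and \<open>g\<close> meet in the factor \<open>b @ p\<close>.\<close>

locale root_splice =
  fixes p b g u :: "'a list" and x :: 'a
  assumes prefix_root: "prefix g (p @ x # b)"
    and root_commute: "g @ p @ x # b = (p @ x # b) @ g"
    and length_p_less: "length p < length g"
    and suffix_b: "suffix b u"
begin

lemma prefix_p: "prefix p g"
  by (rule prefix_length_prefix[OF _ prefix_root]) (use length_p_less in simp_all)

lemma suffix_append_root: "suffix (p @ x # b) (u @ g)"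
proof -
  have "suffix (p @ x # b) ((p @ x # b) @ g)"
    unfolding root_commute[symmetric] by (simp add: suffix_def)
  moreover have "suffix (b @ g) ((p @ x # b) @ g)"
    by (simp add: suffix_def)
  ultimately have "suffix (p @ x # b) (b @ g)"
    by (rule suffix_length_suffix) (use length_p_less in simp)
  also obtain v where "u = v @ b"
    using suffix_b by (elim suffixE)
  then have "suffix (b @ g) (u @ g)"
    by (simp add: suffix_def)
  finally show ?thesis .
qed

lemma sublist_insert_root:
  assumes "sublist s (u @ p @ q)" and "length s \<le> length (p @ x # b)"
  shows "sublist s (u @ g @ p @ q)"
proof -
  obtain v where v: "u = v @ b" using suffix_b by (elim suffixE)
  have "sublist s (v @ b @ p) \<or> sublist s ((b @ p) @ q)"
    using sublist_append_appendD[of s v "b @ p" q] assms by (simp add: v)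
  then consider "sublist s (u @ p)" | "sublist s (b @ p @ q)"
    by (auto simp: v)
  then show ?thesis
  proof cases
    case 1
    moreover have "prefix (u @ p) (u @ g @ p @ q)"
      using prefix_p by simp
    ultimately show ?thesis
      by (meson prefix_imp_sublist sublist_order.order_trans)
  next
    case 2
    moreover have "suffix b (u @ g)"
      by (rule suffix_ConsD[OF suffix_appendD[OF suffix_append_root]])
    then have "suffix (b @ p @ q) (u @ g @ p @ q)"
      by (metis append_assoc same_suffix_suffix)
    ultimately show ?thesis
      by (meson suffix_imp_sublist sublist_order.order_trans)
  qed
qed

lemma sublist_rotate_append_root:
  assumes "i \<le> length g"
  shows "sublist (rotate i (p @ x # b)) (u @ g @ p)"
proof -
  let ?w = "p @ x # b"
  have "rotate i ?w = drop i ?w @ take i ?w"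
    using rotate_append[of "take i ?w" "drop i ?w"] assms prefix_length_le[OF prefix_root]
    by (simp del: take_append drop_append)
  also have "sublist \<dots> (u @ g @ p)"
  proof (cases "i \<le> length p")
    case True
    have "suffix (drop i ?w) (u @ g)"
      using suffix_drop suffix_append_root by (rule suffix_order.order_trans)
    moreover have "prefix (take i ?w) p"
      using True by (simp add: take_is_prefix)
    ultimately show ?thesis
      using sublist_append[of "drop i ?w @ take i ?w" "u @ g" p] by auto
  next
    case False
    then have "drop i ?w = drop (i - Suc (length p)) b"
      by (simp add: drop_Cons')
    then have "suffix (drop i ?w) u"
      using suffix_drop[of "i - Suc (length p)" b] suffix_b by (metis suffix_order.order_trans)
    moreover obtain zs where "?w = g @ zs"
      using prefix_root by (elim prefixE)
    then have "prefix (take i ?w) (g @ p)"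
      using assms by (simp add: take_is_prefix)
    ultimately show ?thesis
      using sublist_append[of "drop i ?w @ take i ?w" u "g @ p"] by auto
  qed
  finally show ?thesis .
qed

end

lemma nth_append_prefix:
  assumes "prefix z u" and "i < length (u @ z)"
  shows "(u @ z) ! i = u ! (i mod length u)"
proof (cases "i < length u")
  case True
  then show ?thesis by (simp add: nth_append)
next
  case False
  moreover have "i - length u < length u"
    using assms False prefix_length_le[OF assms(1)] by simp
  moreover have "z ! j = u ! j" if "j < length z" for j
    using assms(1) that by (auto simp: prefix_def nth_append)
  ultimately show ?thesis
    using assms(2) by (simp add: nth_append mod_if)
qed

lemma in_sub_if_sublist_append_prefix:
  assumes "prefix z u" and "length z < length s" and "sublist s (u @ z)"
  shows "s \<in> sub (length s) u"
proof -
  obtain ps qs where split: "u @ z = ps @ s @ qs"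
    using assms(3) by (auto simp: sublist_def)
  have lengths: "length u + length z = length ps + length s + length qs"
    using arg_cong[OF split, of length] by simp
  have "cyclic_window (length s) u (length ps) = s"
  proof (rule nth_equalityI)
    fix j
    assume "j < length (cyclic_window (length s) u (length ps))"
    then have j: "j < length s" by (simp add: cyclic_window_def)
    have "u ! ((length ps + j) mod length u) = (u @ z) ! (length ps + j)"
      using nth_append_prefix[OF assms(1)] j lengths by simp
    also have "\<dots> = s ! j"
      using j by (simp add: split nth_append)
    finally show "cyclic_window (length s) u (length ps) ! j = s ! j"
      using j by (simp add: cyclic_window_def)
  qed (simp add: cyclic_window_def)
  moreover have "length ps < length u"
    using lengths assms(2) by simp
  ultimately show ?thesis by (force simp: sub_def)
qed

lemma sub_subset_strings:
  assumes "set u \<subseteq> {..<k}"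
  shows "sub n u \<subseteq> strings k n"
proof -
  have "u ! (i mod length u) \<in> {..<k}" if "u \<noteq> []" for i
    using assms that by (meson length_greater_0_conv mod_less_divisor nth_mem subsetD)
  then show ?thesis
    by (fastforce simp: sub_def cyclic_window_def strings_def)
qed

lemma universal_cycleI:
  assumes "u \<noteq> []" and "set u \<subseteq> {..<k}" and "S \<subseteq> sub n u" and "length u = card S"
  shows "universal_cycle k n S u"
proof -
  have "card (sub n u) \<le> card S"
    using card_image_le[of "{..<length u}" "cyclic_window n u"] assms(4) by (simp add: sub_def)
  then have S: "S = cyclic_window n u ` {..<length u}"
    using card_seteq[OF _ assms(3)] by (simp add: sub_def)
  then have "inj_on (cyclic_window n u) {..<length u}"
    using assms(4) by (intro eq_card_imp_inj_on) simp_all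
  then have "\<forall>s\<in>S. \<exists>!i. i < length u \<and> cyclic_window n u i = s"
    unfolding S by (auto simp: inj_on_def)
  moreover have "S \<noteq> {}"
    using assms(1,4) by auto
  moreover have "S \<subseteq> strings k n"
    using assms(3) sub_subset_strings[OF assms(2)] by (rule order_trans)
  ultimately show ?thesis
    unfolding universal_cycle_def using assms(2,4) by blast
qed

subsection \<open>Necklaces\<close>

lemma necklace_iff_append:
  "necklace w \<longleftrightarrow> (\<forall>a b. w = a @ b \<longrightarrow> w \<le> b @ a)"
proof
  assume "necklace w"
  then show "\<forall>a b. w = a @ b \<longrightarrow> w \<le> b @ a"
    unfolding necklace_def by (metis rotate_append)
next
  assume "\<forall>a b. w = a @ b \<longrightarrow> w \<le> b @ a"
  then show "necklace w"
    unfolding necklace_def by (metis append_take_drop_id rotate_drop_take)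
qed

lemma necklace_zeros: "necklace (replicate n 0)"
proof -
  have "rotate i (replicate n 0) = replicate n (0::nat)" for i
    by (induction i) simp_all
  then show ?thesis by (simp add: necklace_def)
qed

lemma leading_zerosE:
  fixes w :: "nat list"
  assumes "w \<noteq> replicate (length w) 0"
  obtains j x b where "w = replicate j 0 @ x # b" and "0 < x"
proof -
  have "\<exists>x\<in>set w. 0 < x"
    using assms replicate_length_same[of w 0] by (metis gr0I)
  then obtain z x b where w: "w = z @ x # b" "0 < x" "\<forall>y\<in>set z. \<not> 0 < y"
    by (rule split_list_first_propE)
  then have "z = replicate (length z) 0"
    using replicate_length_same[of z 0] by auto
  then show thesis using w that by metis
qed

lemma necklace_lower_first_pos:
  assumes "necklace (replicate j 0 @ x # b)" and "y < x"
  shows "necklace (replicate j 0 @ y # b)" (is "necklace ?w")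
  unfolding necklace_iff_append
proof (intro allI impI)
  fix a c
  assume split: "?w = a @ c"
  consider "c = []" | "length a \<le> j" | e where "a = replicate j 0 @ y # e" "b = e @ c" "c \<noteq> []"
    using split
    by (auto simp: append_eq_append_conv2 Cons_eq_append_conv dest: arg_cong[of _ _ length])
  then show "?w \<le> c @ a"
  proof cases
    case 1
    then show ?thesis using split by simp
  next
    case 2
    then have "a = replicate (length a) 0"
      using arg_cong[OF split, of "take (length a)"] by (simp add: min_def)
    then show ?thesis
      using split replicate_append_le_append_replicate by (metis zero_le)
  next
    case 3
    have "take (Suc j) ?w < replicate j 0 @ [x]"
      using assms(2) by (simp add: append_less_append_iff)
    also have "replicate j 0 @ x # b \<le> c @ replicate j 0 @ x # e"
      using assms(1) 3(2) unfolding necklace_iff_append by (metis append.assoc append_Cons)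
    then have "replicate j 0 @ [x] \<le> take (Suc j) (c @ replicate j 0 @ x # e)"
      using take_mono_le[of _ _ "Suc j"] by fastforce
    also have "\<dots> = take (Suc j) (c @ a)"
      using 3 by (cases c) auto
    finally show ?thesis
      by (rule less_imp_le[OF less_if_take_less])
  qed
qed

lemma necklace_trailing_zeros:
  assumes "necklace (replicate j 0 @ x # replicate l 0)" and "0 < x"
  shows "l = 0"
proof (rule ccontr)
  assume "l \<noteq> 0"
  have "replicate j 0 @ x # replicate l 0 \<le> replicate l 0 @ replicate j 0 @ [x]"
    using assms(1) unfolding necklace_iff_append by (metis append.assoc append_Cons append_Nil)
  also have "\<dots> = replicate j 0 @ replicate l 0 @ [x]"
    by (metis add.commute append.assoc replicate_add)
  also have "\<dots> < replicate j 0 @ x # replicate l 0"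
    using \<open>l \<noteq> 0\<close> assms(2) by (cases l) (auto simp: append_less_append_iff)
  finally show False by simp
qed

lemma sub_necklaces_disjoint:
  assumes "necklace v" and "necklace w" and "length v = length w" and "v \<noteq> w"
  shows "sub (length w) v \<inter> sub (length w) w = {}"
proof (rule ccontr)
  assume meet: "sub (length w) v \<inter> sub (length w) w \<noteq> {}"
  have nonempty: "v \<noteq> []" "w \<noteq> []"
    using assms(3,4) by auto
  then obtain s where "s \<in> orbit rotate1 v" "s \<in> orbit rotate1 w"
    using meet sub_eq_orbit[of v] sub_eq_orbit[of w] assms(3) by auto
  then have "v \<in> orbit rotate1 w" "w \<in> orbit rotate1 v"
    using nonempty self_in_orbit_rotate1 by (meson orbit_swap orbit_trans)+
  moreover have "a \<le> b" if "necklace a" "b \<in> orbit rotate1 a" for a b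
    using that by (auto simp: necklace_def orbit_altdef rotate_def)
  ultimately show False
    using assms(1,2,4) by (metis order_antisym)
qed

lemma leading_zeros_less_length_pr:
  assumes "0 < x"
  shows "j < length (pr (replicate j 0 @ x # b))" (is "j < length (pr ?w)")
proof (rule ccontr)
  assume "\<not> j < length (pr ?w)"
  then have "prefix (pr ?w) (replicate j 0)"
    using prefix_length_prefix[OF prefix_pr, of "replicate j 0" ?w] by simp
  then have "set (pr ?w) \<subseteq> {0}"
    using set_mono_prefix by fastforce
  then show False
    using set_pr[of ?w] assms by auto
qed

lemma prefix_leading_zeros_pr:
  assumes "0 < x"
  shows "prefix (replicate j 0) (pr (replicate j 0 @ x # b))"
  using leading_zeros_less_length_pr[OF assms, of j b]
  by (intro prefix_length_prefix[OF _ prefix_pr]) simp_all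

lemma root_splice_pr:
  assumes "0 < x" and "suffix b u"
  shows "root_splice (replicate j 0) b (pr (replicate j 0 @ x # b)) u x"
  using prefix_pr pr_append_commute leading_zeros_less_length_pr assms
  by unfold_locales simp_all

lemma replicate_length_append_Cons_minus_1:
  "replicate (length (replicate j y @ x # b) - 1) y = replicate j y @ replicate (length b) y"
  by (simp add: replicate_add)

lemma sublist_append_pr_zeros:
  assumes "w = replicate j 0 @ x # b" and "0 < x" and "suffix b u"
    and "sublist s (u @ replicate (length w - 1) 0)" and "length s \<le> length w"
  shows "sublist s (u @ pr w @ replicate (length w - 1) 0)"
proof -
  interpret root_splice "replicate j 0" b "pr w" u x
    unfolding assms(1) using assms(2,3) by (rule root_splice_pr)
  show ?thesis
    using sublist_insert_root assms(4,5) unfolding assms(1) replicate_length_append_Cons_minus_1 by simp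
qed

lemma sub_sublist_append_pr_zeros:
  assumes "w = replicate j 0 @ x # b" and "0 < x" and "suffix b u" and "s \<in> sub (length w) w"
  shows "sublist s (u @ pr w @ replicate (length w - 1) 0)"
proof -
  interpret root_splice "replicate j 0" b "pr w" u x
    unfolding assms(1) using assms(2,3) by (rule root_splice_pr)
  have "w \<noteq> []" using assms(1) by simp
  then obtain i where "s = rotate i w" "i < length (pr w)"
    using sub_eq_rotate_less_length_pr assms(4) by blast
  then have "sublist s (u @ pr w @ replicate j 0)"
    using sublist_rotate_append_root[of i] by (simp add: assms(1))
  then have "sublist s ((u @ pr w @ replicate j 0) @ replicate (length b) 0)"
    unfolding sublist_append by (rule disjI1)
  then show ?thesis
    unfolding assms(1) replicate_length_append_Cons_minus_1 by simp
qed

lemma pr_zeros: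
  assumes "0 < n"
  shows "pr (replicate n 0) = [0]"
proof -
  let ?w = "replicate n (0::nat)"
  have fixed: "(rotate1 ^^ 1) ?w = ?w" by simp
  have "length (pr ?w) = 1"
    using least_power_le[OF fixed] least_powerI(2)[OF fixed] assms by (simp add: length_pr)
  then obtain y where "pr ?w = [y]"
    by (metis One_nat_def length_0_conv length_Suc_conv)
  then show ?thesis
    using assms set_pr[of ?w] by simp
qed

lemma UC_append: "UC (xs @ ys) = UC xs @ UC ys"
  by (simp add: UC_def)

lemma UC_take_Suc:
  assumes "m < length ws"
  shows "UC (take (Suc m) ws) = UC (take m ws) @ pr (ws ! m)"
  using assms by (simp add: take_Suc_conv_app_nth UC_def)

locale colex_necklaces =
  fixes k n :: nat and necks :: "nat list list"
  assumes k_pos: "0 < k" and n_pos: "0 < n"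
    and set_necks: "set necks = Neck k n" and sorted_necks: "sorted_wrt colex_less necks"
begin

lemma necksD:
  assumes "w \<in> set necks"
  shows "necklace w" and "length w = n" and "set w \<subseteq> {..<k}"
  using assms unfolding set_necks Neck_def strings_def by auto

lemma rev_necks_strict_sorted: "sorted_wrt (<) (map rev necks)"
  unfolding sorted_wrt_map
  using sorted_necks colex_less_imp_rev_less by (rule sorted_wrt_mono_rel[rotated])

lemma distinct_necks: "distinct necks"
  using rev_necks_strict_sorted by (simp add: strict_sorted_iff distinct_map)

lemma rev_necks_nth_le_iff:
  assumes "i < length necks" and "l < length necks"
  shows "rev (necks ! i) \<le> rev (necks ! l) \<longleftrightarrow> i \<le> l"
  using sorted_wrt_nth_less[OF rev_necks_strict_sorted, of i l]
    sorted_wrt_nth_less[OF rev_necks_strict_sorted, of l i] assms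
  by (cases i l rule: linorder_cases) auto

lemma zeros_in_necks: "replicate n 0 \<in> set necks"
  unfolding set_necks Neck_def strings_def using necklace_zeros k_pos by auto

lemma first_necklace_eq_zeros: "necks ! 0 = replicate n 0"
proof -
  obtain i where i: "i < length necks" "necks ! i = replicate n 0"
    using zeros_in_necks by (auto simp: in_set_conv_nth)
  then have "rev (necks ! i) \<le> rev (necks ! 0)"
    using replicate_length_le[of "rev (necks ! 0)" 0] necksD(2)[OF nth_mem[of 0 necks]] by force
  then have "i = 0"
    using rev_necks_nth_le_iff[of i 0] i(1) by fastforce
  then show ?thesis using i(2) by simp
qed

lemma take_1_necks: "take 1 necks = [replicate n 0]"
  using zeros_in_necks first_necklace_eq_zeros by (cases necks) auto

lemma necks_nth_leading_zerosE:
  assumes "0 < i" and "i < length necks"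
  obtains j x b where "necks ! i = replicate j 0 @ x # b" and "0 < x"
proof (rule leading_zerosE)
  have "0 < length necks" using assms by linarith
  then have "necks ! i \<noteq> necks ! 0"
    using nth_eq_iff_index_eq[OF distinct_necks assms(2)] assms(1) by blast
  then show "necks ! i \<noteq> replicate (length (necks ! i)) 0"
    using first_necklace_eq_zeros necksD(2)[OF nth_mem[OF assms(2)]] by simp
qed

lemma tail_suffix_previous_necklace:
  assumes "Suc i < length necks" and "necks ! Suc i = replicate j 0 @ x # b" and "0 < x"
  shows "suffix b (necks ! i)"
proof -
  let ?lowered = "replicate j 0 @ 0 # b"
  have "?lowered \<in> set necks"
    using necklace_lower_first_pos[of j x b 0] necksD[OF nth_mem[OF assms(1)]] assms(2,3) k_pos
    unfolding set_necks Neck_def strings_def by auto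
  then obtain l where l: "l < length necks" "necks ! l = ?lowered"
    by (auto simp: in_set_conv_nth)
  have "rev ?lowered < rev (necks ! Suc i)"
    using assms(2,3) by (simp add: append_less_append_iff)
  then have "l \<le> i"
    using rev_necks_nth_le_iff[of "Suc i" l] assms(1) l by fastforce
  then have "rev b @ 0 # replicate j 0 \<le> rev (necks ! i)"
    using rev_necks_nth_le_iff[of l i] assms(1) l by simp
  moreover have "rev (necks ! i) \<le> rev b @ x # replicate j 0"
    using rev_necks_nth_le_iff[of i "Suc i"] assms(1,2) by simp
  ultimately show ?thesis
    unfolding suffix_to_prefix by (rule prefix_if_lex_between)
qed

lemma second_necklace_tail_eq_Nil:
  assumes "1 < length necks" and "necks ! 1 = replicate j 0 @ x # b" and "0 < x"
  shows "b = []"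
proof -
  have "suffix b (replicate n 0)"
    using tail_suffix_previous_necklace[of 0 j x b] assms first_necklace_eq_zeros by simp
  then have "b = replicate (length b) 0"
    using set_mono_suffix replicate_length_same[of b 0] by fastforce
  then show ?thesis
    using necklace_trailing_zeros[of j x "length b"] necksD(1)[OF nth_mem[OF assms(1)]] assms(2,3)
    by simp
qed

lemma tail_suffix_UC:
  assumes "0 < i" and "i < length necks" and "necks ! i = replicate j 0 @ x # b" and "0 < x"
  shows "suffix b (UC (take i necks))"
  using assms
proof (induction i arbitrary: j x b rule: nat_induct_non_zero)
  case 1
  then have "b = []" by (rule second_necklace_tail_eq_Nil)
  then show ?case by simp
next
  case (Suc i)
  obtain j' x' b' where w: "necks ! i = replicate j' 0 @ x' # b'" "0 < x'"
    using necks_nth_leading_zerosE Suc.hyps Suc.prems(1) by (metis Suc_lessD)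
  then interpret root_splice "replicate j' 0" b' "pr (necks ! i)" "UC (take i necks)" x'
    using root_splice_pr Suc by (metis Suc_lessD)
  have "suffix b (necks ! i)"
    using tail_suffix_previous_necklace Suc.prems by blast
  also have "suffix \<dots> (UC (take i necks) @ pr (necks ! i))"
    using suffix_append_root w(1) by simp
  also have "\<dots> = UC (take (Suc i) necks)"
    using Suc.prems(1) by (simp add: UC_take_Suc)
  finally show ?case .
qed

lemma sublist_UC_append_zeros:
  assumes "0 < m" and "m \<le> length necks" and "w \<in> set (take m necks)" and "s \<in> sub n w"
  shows "sublist s (UC (take m necks) @ replicate (n - 1) 0)"
  using assms
proof (induction m rule: nat_induct_non_zero)
  case 1
  then have "s = replicate n 0"
    unfolding take_1_necks by (auto simp: sub_def cyclic_window_def map_replicate_const)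
  moreover have "UC (take 1 necks) @ replicate (n - 1) 0 = replicate n 0"
    unfolding take_1_necks using n_pos by (simp add: UC_def pr_zeros flip: replicate_Suc)
  ultimately show ?case by simp
next
  case (Suc m)
  have m: "0 < m" "m < length necks" using Suc by simp_all
  obtain j x b where v: "necks ! m = replicate j 0 @ x # b" "0 < x"
    using necks_nth_leading_zerosE m by metis
  have suffix: "suffix b (UC (take m necks))"
    using m v by (rule tail_suffix_UC)
  have n: "length (necks ! m) = n"
    using necksD(2)[OF nth_mem[OF m(2)]] .
  have "sublist s (UC (take m necks) @ pr (necks ! m) @ replicate (n - 1) 0)"
  proof (cases "w \<in> set (take m necks)")
    case True
    then have "sublist s (UC (take m necks) @ replicate (n - 1) 0)"
      using Suc m(2) by simp
    moreover have "length s = n"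
      using Suc.prems by (auto simp: sub_def cyclic_window_def)
    ultimately show ?thesis
      using sublist_append_pr_zeros[OF v suffix] n by simp
  next
    case False
    then have "w = necks ! m"
      using Suc.prems(2) m(2) by (simp add: take_Suc_conv_app_nth)
    then show ?thesis
      using sub_sublist_append_pr_zeros[OF v suffix] Suc.prems(3) n by simp
  qed
  then show ?case
    using m(2) by (simp add: UC_take_Suc)
qed

lemma prefix_zeros_UC:
  assumes "2 \<le> m" and "m \<le> length necks"
  shows "prefix (replicate n 0) (UC (take m necks))"
proof -
  have len: "1 < length necks" using assms by simp
  obtain j x b where w: "necks ! 1 = replicate j 0 @ x # b" "0 < x"
    using necks_nth_leading_zerosE[of 1] len by auto
  then have "b = []"
    by (rule second_necklace_tail_eq_Nil[OF len])
  then have "n = Suc j"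
    using w necksD(2)[OF nth_mem[OF len]] by simp
  then have "prefix (replicate n 0) ([0] @ pr (necks ! 1))"
    using prefix_leading_zeros_pr w by simp
  also have "\<dots> = UC (take 1 necks) @ pr (necks ! 1)"
    unfolding take_1_necks using n_pos by (simp add: UC_def pr_zeros)
  also have "\<dots> = UC (take 2 necks)"
    using UC_take_Suc[OF len] by (simp add: numeral_2_eq_2)
  also have "prefix \<dots> (UC (take m necks))"
    using assms(1) UC_append by (metis le_add_diff_inverse prefixI take_add)
  finally show ?thesis .
qed

lemma sub_subset_sub_UC:
  assumes "2 \<le> m" and "m \<le> length necks" and "w \<in> set (take m necks)"
  shows "sub n w \<subseteq> sub n (UC (take m necks))"
proof
  fix s
  assume s: "s \<in> sub n w"
  have "sublist s (UC (take m necks) @ replicate (n - 1) 0)"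
    using sublist_UC_append_zeros assms s by simp
  moreover have "prefix (replicate (n - 1) 0) (UC (take m necks))"
    using prefix_zeros_UC[OF assms(1,2)] n_pos
    by (metis Suc_pred' append_prefixD replicate_Suc replicate_append_same)
  moreover have "length s = n"
    using s by (auto simp: sub_def cyclic_window_def)
  ultimately show "s \<in> sub n (UC (take m necks))"
    using in_sub_if_sublist_append_prefix n_pos by fastforce
qed

lemma length_UC: "length (UC (take m necks)) = card (\<Union>w\<in>set (take m necks). sub n w)"
proof -
  let ?A = "set (take m necks)"
  have A: "necklace w" "length w = n" if "w \<in> ?A" for w
    using necksD[OF in_set_takeD[OF that]] by simp_all
  have "length (UC (take m necks)) = (\<Sum>w\<in>?A. length (pr w))"
    using distinct_necks by (simp add: UC_def length_concat comp_def sum_list_distinct_conv_sum_set)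
  also have "\<dots> = (\<Sum>w\<in>?A. card (sub n w))"
  proof (rule sum.cong)
    show "length (pr w) = card (sub n w)" if "w \<in> ?A" for w
      using card_sub[of w] A(2)[OF that] n_pos by fastforce
  qed simp
  also have "\<dots> = card (\<Union>w\<in>?A. sub n w)"
  proof (rule card_UN_disjoint[symmetric])
    show "\<forall>v\<in>?A. \<forall>w\<in>?A. v \<noteq> w \<longrightarrow> sub n v \<inter> sub n w = {}"
      using A sub_necklaces_disjoint by metis
  qed (simp_all add: sub_def)
  finally show ?thesis .
qed

lemma set_UC_subset: "set (UC (take m necks)) \<subseteq> {..<k}"
proof -
  have "set w \<subseteq> {..<k}" if "w \<in> set (take m necks)" for w
    using necksD(3) in_set_takeD[OF that] by blast
  then show ?thesis by (auto simp: UC_def set_pr)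
qed

end

theorem theorem3:
  fixes k n m :: nat and necks :: "nat list list"
  assumes "2 \<le> k" and "2 \<le> n" and "2 \<le> m" and "m \<le> card (Neck k n)"
    and "set necks = Neck k n" and "sorted_wrt colex_less necks"
  shows "universal_cycle k n (\<Union>\<alpha>\<in>set (take m necks). sub n \<alpha>) (UC (take m necks))"
proof -
  interpret colex_necklaces k n necks
    using assms by unfold_locales simp_all
  have m: "m \<le> length necks"
    using assms(4,5) card_length[of necks] by simp
  show ?thesis
  proof (rule universal_cycleI)
    show "UC (take m necks) \<noteq> []"
      using prefix_zeros_UC[OF assms(3) m] assms(2) by auto
    show "set (UC (take m necks)) \<subseteq> {..<k}"
      by (rule set_UC_subset)
    show "(\<Union>\<alpha>\<in>set (take m necks). sub n \<alpha>) \<subseteq> sub n (UC (take m necks))"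
      using sub_subset_sub_UC[OF assms(3) m] by blast
    show "length (UC (take m necks)) = card (\<Union>\<alpha>\<in>set (take m necks). sub n \<alpha>)"
      by (rule length_UC)
  qed
qed

end
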